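(* Let $\mathbb{A}$ be a symmetric association scheme in which one of the relations is a lattice graph $L_2(n)$. If a relation of $\mathbb{A}$ is strongly regular, then it is of Latin square type.
   Context: A $d$-class (symmetric) association scheme is a set of $d+1$ nonzero symmetric $01$-matrices $\{A_0=I,A_1,\dots,A_d\}$ of the same size $v$ that sum to the all-ones matrix $J$ and whose span is an algebra under ordinary matrix multiplication. The matrices $A_1,\dots,A_d$ are identified with the graphs of which they are adjacency matrices, and are called the relations of the scheme. A graph is strongly regular if it is one of the (non-identity) relations of a $2$-class association scheme. Its restricted eigenvalues are its eigenvalues on the nontrivial common eigenspaces of that $2$-class scheme (the ones other than the span of the all-ones vector). A strongly regular graph on $v$ vertices with valency $k$ is of Latin square type if $v=n^2$, $k=t(n-1)$, and its restricted eigenvalues are $n-t$ and $-t$, for some positive integers $n$ and $t$. The lattice graph $L_2(n)$ has vertex set $\{(i,j): i,j=1,\dots,n\}$, where two distinct vertices are adjacent if they agree in the first or in the second coordinate. *)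

theory Defs
  imports "HOL-Analysis.Analysis"
begin

type_synonym 'v sqmat = "real ^ 'v ^ 'v"

text \<open>The matrices are indexed by the finite vertex type, so the order \<open>v\<close> of a scheme is
  \<open>CARD('v)\<close>. (The all-ones matrix is written out because \<open>mat 1\<close> is the identity matrix, whereas
  the numeral \<open>1\<close> of this type is all-ones.)\<close>

definition all_ones_matrix :: "'v::finite sqmat" where
  "all_ones_matrix = (\<chi> x y. 1)"

definition all_ones_vector :: "real ^ 'v::finite" where
  "all_ones_vector = (\<chi> x. 1)"

definition association_scheme :: "nat \<Rightarrow> 'v::finite sqmat set \<Rightarrow> bool" where
  "association_scheme d S \<longleftrightarrow>
     finite S \<and> card S = d + 1 \<and> mat 1 \<in> S \<and>
     (\<forall>A\<in>S. A \<noteq> 0 \<and> transpose A = A \<and> (\<forall>x y. A $ x $ y \<in> {0, 1})) \<and>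
     (\<Sum>A\<in>S. A) = all_ones_matrix \<and>
     (\<forall>M\<in>span S. \<forall>N\<in>span S. M ** N \<in> span S)"

definition relations :: "'v::finite sqmat set \<Rightarrow> 'v sqmat set" where
  "relations S = S - {mat 1}"

definition strongly_regular :: "'v::finite sqmat \<Rightarrow> bool" where
  "strongly_regular A \<longleftrightarrow> (\<exists>T. association_scheme 2 T \<and> A \<in> relations T)"

definition has_valency :: "'v::finite sqmat \<Rightarrow> nat \<Rightarrow> bool" where
  "has_valency A k \<longleftrightarrow> (\<forall>x. card {y. A $ x $ y = 1} = k)"

text \<open>A common eigenspace of \<open>S\<close> is a nonzero subspace of the following form, where \<open>\<theta> A\<close> is the
  eigenvalue of \<open>A \<in> S\<close> on it.\<close>

definition joint_eigenspace ::
    "'v::finite sqmat set \<Rightarrow> ('v sqmat \<Rightarrow> real) \<Rightarrow> (real ^ 'v) set" where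
  "joint_eigenspace S \<theta> = {u. \<forall>A\<in>S. A *v u = \<theta> A *\<^sub>R u}"

definition restricted_eigenvalues :: "'v::finite sqmat set \<Rightarrow> 'v sqmat \<Rightarrow> real set" where
  "restricted_eigenvalues S A =
     {\<theta> A |\<theta>. joint_eigenspace S \<theta> \<noteq> {0} \<and> joint_eigenspace S \<theta> \<noteq> span {all_ones_vector}}"

text \<open>The 2-class scheme \<open>T\<close> below is determined by \<open>A\<close>: it consists of the identity, \<open>A\<close>, and the
  adjacency matrix of the complementary graph.\<close>

definition latin_square_type :: "'v::finite sqmat \<Rightarrow> bool" where
  "latin_square_type A \<longleftrightarrow>
     (\<exists>T. association_scheme 2 T \<and> A \<in> relations T \<and>
       (\<exists>n t :: nat. n > 0 \<and> t > 0 \<and> CARD('v) = n ^ 2 \<and> has_valency A (t * (n - 1)) \<and>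
          restricted_eigenvalues T A = {real n - real t, - real t}))"

definition lattice_vertices :: "nat \<Rightarrow> (nat \<times> nat) set" where
  "lattice_vertices n = {1..n} \<times> {1..n}"

definition lattice_adjacent :: "nat \<times> nat \<Rightarrow> nat \<times> nat \<Rightarrow> bool" where
  "lattice_adjacent p q \<longleftrightarrow> p \<noteq> q \<and> (fst p = fst q \<or> snd p = snd q)"

text \<open>Being a lattice graph is understood up to graph isomorphism \<open>f\<close>.\<close>

definition is_lattice_graph :: "nat \<Rightarrow> 'v::finite sqmat \<Rightarrow> bool" where
  "is_lattice_graph n A \<longleftrightarrow>
     (\<exists>f. bij_betw f UNIV (lattice_vertices n) \<and>
        A = (\<chi> x y. if lattice_adjacent (f x) (f y) then 1 else 0))"

end

theory Submission
  imports Defs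
begin

text \<open>
  View the vertices as the cells of an \<open>n \<times> n\<close> array, and let \<open>\<rho>\<close> be the indicator vector of one
  row of the array. Everything rests on the fact that the partition into rows is equitable for \<open>B\<close>
  in a strong form: \<open>B \<rho> = \<alpha> \<rho> + \<beta> 1\<close> with the same \<open>\<alpha>\<close> and \<open>\<beta>\<close> for all rows.

  If \<open>B \<noteq> L\<close>, then a \<open>B\<close>-neighbour of \<open>x\<close> lies neither in the row nor in the column of \<open>x\<close>. For
  another row \<open>a\<close>, let \<open>y\<close> be the cell of row \<open>a\<close> in the column of \<open>x\<close>. The \<open>B\<close>-neighbours of \<open>x\<close>
  that are \<open>L\<close>-adjacent to \<open>y\<close> are then exactly those in row \<open>a\<close>, and their number is the entry
  \<open>(B L)\<^sub>x\<^sub>y\<close>. As \<open>B L\<close> lies in the algebra of the scheme and \<open>x\<close>, \<open>y\<close> are in relation \<open>L\<close>, this number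
  is some \<open>t\<close> independent of \<open>x\<close> and \<open>a\<close> (lemma \<open>neighbours_in_lattice_row\<close>). So \<open>\<alpha> = -t\<close> and
  \<open>\<beta> = t\<close>. If \<open>B = L\<close>, counting gives \<open>\<alpha> = n - 2\<close> and \<open>\<beta> = 1\<close>, and \<open>t = 2\<close>.

  Strong regularity says \<open>B\<^sup>2 = a I + b B + c J\<close>. Evaluating this on \<open>\<rho>\<close> at a cell inside and at a
  cell outside of the row, together with the diagonal entry \<open>a + c = k\<close>, gives three linear equations
  for \<open>a\<close>, \<open>b\<close>, \<open>c\<close> (lemma \<open>srg_parameters_from_rows\<close>), with the solution
  \<open>(B - (n - t) I) (B + t I) = c J\<close>. Such a quadratic equation determines the restricted eigenvalues
  (lemma \<open>restricted_eigenvalues_of_quadratic\<close>).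
\<close>

section \<open>Association schemes\<close>

lemma scheme_entry:
  assumes "association_scheme d S" "A \<in> S"
  shows "A $ x $ y = 0 \<or> A $ x $ y = 1"
  using assms unfolding association_scheme_def by fastforce

lemma scheme_symmetric:
  assumes "association_scheme d S" "A \<in> S"
  shows "transpose A = A" "A $ x $ y = A $ y $ x"
proof -
  show "transpose A = A" using assms unfolding association_scheme_def by blast
  then show "A $ x $ y = A $ y $ x" by (metis transpose_def vec_lambda_beta)
qed

lemma scheme_disjoint:
  assumes S: "association_scheme d S" and A: "A \<in> S" "A' \<in> S" "A \<noteq> A'" and 1: "A $ x $ y = 1"
  shows "A' $ x $ y = 0"
proof (rule ccontr)
  assume "A' $ x $ y \<noteq> 0"
  then have 2: "A' $ x $ y = 1" using scheme_entry[OF S A(2)] by blast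
  have fin: "finite S" and J: "(\<Sum>X\<in>S. X) = all_ones_matrix"
    using S unfolding association_scheme_def by blast+
  have "(\<Sum>X\<in>S. X $ x $ y) = (\<Sum>X\<in>S. X) $ x $ y" by simp
  also have "\<dots> = 1" by (simp add: J all_ones_matrix_def)
  finally have s1: "(\<Sum>X\<in>S. X $ x $ y) = 1" .
  have "(\<Sum>X\<in>{A, A'}. X $ x $ y) \<le> (\<Sum>X\<in>S. X $ x $ y)"
  proof (rule sum_mono2[OF fin])
    show "{A, A'} \<subseteq> S" using A by blast
    show "0 \<le> X $ x $ y" if "X \<in> S - {A, A'}" for X
      using scheme_entry[OF S, of X x y] that by auto
  qed
  then show False using A 1 2 s1 by simp
qed

lemma relation_diagonal:
  assumes S: "association_scheme d S" and A: "A \<in> relations S"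
  shows "A $ x $ x = 0"
proof (rule scheme_disjoint[OF S])
  show "mat 1 \<in> S" using S unfolding association_scheme_def by blast
  show "A \<in> S" "mat 1 \<noteq> A" using A unfolding relations_def by blast+
qed (simp add: mat_def)

lemma relation_nonzero_entry:
  assumes S: "association_scheme d S" and A: "A \<in> relations S"
  obtains x y where "x \<noteq> y" "A $ x $ y = 1"
proof -
  have AS: "A \<in> S" using A unfolding relations_def by blast
  then have "A \<noteq> 0" using S unfolding association_scheme_def by blast
  then obtain x y where "A $ x $ y \<noteq> 0" by (metis vec_eq_iff zero_index)
  then have "A $ x $ y = 1" using scheme_entry[OF S AS] by blast
  then show thesis using that relation_diagonal[OF S A] by (metis zero_neq_one)
qed

text \<open>The span consists of the linear combinations of 01-matrices with disjoint supports.\<close>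

lemma span_constant_on_relation:
  assumes S: "association_scheme d S" and A: "A \<in> S" and M: "M \<in> span S"
    and "A $ x $ y = 1" "A $ x' $ y' = 1"
  shows "M $ x $ y = M $ x' $ y'"
proof -
  have "span S \<subseteq> {M. M $ x $ y = M $ x' $ y'}"
  proof (rule span_minimal)
    have "X $ x $ y = X $ x' $ y'" if "X \<in> S" for X
      using scheme_disjoint[OF S A that] assms(4,5) by (cases "X = A") auto
    then show "S \<subseteq> {M. M $ x $ y = M $ x' $ y'}" by blast
  qed (auto simp: subspace_def)
  then show ?thesis using M by blast
qed

lemma all_ones_in_span:
  assumes "association_scheme d S"
  shows "all_ones_matrix \<in> span S"
proof -
  have "(\<Sum>A\<in>S. A) \<in> span S" by (intro span_sum span_base)
  then show ?thesis using assms unfolding association_scheme_def by simp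
qed

lemma commutes_with_all_ones:
  assumes S: "association_scheme d S" and A: "A \<in> S"
  shows "all_ones_matrix ** A = A ** all_ones_matrix"
proof -
  have "span S \<subseteq> {M. transpose M = M}"
  proof (rule span_minimal)
    show "S \<subseteq> {M. transpose M = M}" using scheme_symmetric(1)[OF S] by blast
  qed (auto simp: subspace_def transpose_def vec_eq_iff)
  then have tr: "transpose M = M" if "M \<in> span S" for M using that by blast
  have "A ** all_ones_matrix \<in> span S"
    using S all_ones_in_span[OF S] span_base[OF A] unfolding association_scheme_def by blast
  then have "A ** all_ones_matrix = transpose (A ** all_ones_matrix)" using tr by simp
  also have "\<dots> = all_ones_matrix ** A"
    using tr[OF all_ones_in_span[OF S]] scheme_symmetric(1)[OF S A] by (simp add: matrix_transpose_mul)
  finally show ?thesis by simp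
qed

section \<open>Two-class schemes\<close>

lemma two_class_scheme:
  assumes T: "association_scheme 2 T" and B: "B \<in> relations T"
  obtains C where "T = {mat 1, B, C}" "mat 1 \<noteq> B" "C \<in> relations T" "C \<noteq> B"
    "mat 1 + B + C = all_ones_matrix"
proof -
  have c: "card T = 3" "finite T" "mat 1 \<in> T" and J: "(\<Sum>A\<in>T. A) = all_ones_matrix"
    using T unfolding association_scheme_def by auto
  have B': "B \<in> T" "mat 1 \<noteq> B" using B unfolding relations_def by auto
  have "card (T - {mat 1, B}) = 1" using c B' by (subst card_Diff_subset) auto
  then obtain C where C: "T - {mat 1, B} = {C}" by (meson card_1_singletonE)
  have T': "T = {mat 1, B, C}" using C c B' by blast
  have "C \<noteq> mat 1" "C \<noteq> B" using C by blast+
  with B' have "(\<Sum>A\<in>T. A) = mat 1 + (B + C)" unfolding T' by simp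
  with J have "mat 1 + B + C = all_ones_matrix" by (simp add: add.assoc)
  then show thesis using that[OF T'] B' \<open>C \<noteq> mat 1\<close> \<open>C \<noteq> B\<close> by (auto simp: relations_def T')
qed

lemma two_class_square:
  assumes T: "association_scheme 2 T" and B: "B \<in> relations T"
  obtains a b c where "B ** B = a *\<^sub>R mat 1 + b *\<^sub>R B + c *\<^sub>R all_ones_matrix"
proof -
  obtain C where C: "T = {mat 1, B, C}" "mat 1 + B + C = all_ones_matrix"
    using two_class_scheme[OF T B] by metis
  have "B \<in> span T" using C by (simp add: span_base)
  then have "B ** B \<in> span {mat 1, B, C}" using T unfolding association_scheme_def C(1) by blast
  then obtain a b c where "B ** B - a *\<^sub>R mat 1 - b *\<^sub>R B - c *\<^sub>R C = 0"
    by (auto simp: span_insert)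
  then have "B ** B = (a - c) *\<^sub>R mat 1 + (b - c) *\<^sub>R B + c *\<^sub>R (mat 1 + B + C)"
    by (simp add: algebra_simps)
  then show thesis using that C(2) by metis
qed

lemma all_ones_matrix_mult:
  "(all_ones_matrix :: real ^ 'v ^ 'v) *v w = (\<Sum>x\<in>UNIV. w $ x) *\<^sub>R all_ones_vector"
  by (simp add: all_ones_matrix_def all_ones_vector_def matrix_vector_mult_def vec_eq_iff)

text \<open>A symmetric matrix that kills the orthogonal complement of the all-ones vector has equal
  columns, so all its entries agree.\<close>

lemma nonconstant_matrix_sum_zero_vector:
  fixes M :: "real ^ 'v ^ 'v"
  assumes sym: "\<And>x y. M $ x $ y = M $ y $ x" and ne: "M $ p $ q \<noteq> M $ x $ y"
  obtains w where "all_ones_matrix *v w = 0" "M *v w \<noteq> 0"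
proof -
  have col: "M *v (axis i 1 - axis j 1) = (\<chi> z. M $ z $ i - M $ z $ j)" for i j
    by (simp add: matrix_vector_mult_diff_distrib matrix_vector_mult_basis column_def vec_eq_iff)
  have J: "all_ones_matrix *v (axis i 1 - axis j 1 :: real ^ 'v) = 0" for i j
    by (simp add: matrix_vector_mult_diff_distrib matrix_vector_mult_basis column_def vec_eq_iff
        all_ones_matrix_def)
  have "M $ p $ q \<noteq> M $ p $ y \<or> M $ y $ p \<noteq> M $ y $ x"
    using ne sym[of p y] sym[of x y] by auto
  then obtain i j z where "M $ z $ i \<noteq> M $ z $ j" by blast
  then have "M *v (axis i 1 - axis j 1) \<noteq> 0" unfolding col by (auto simp: vec_eq_iff)
  then show thesis using that J by blast
qed

text \<open>On vectors of coordinate sum 0 the equation reads \<open>(B - \<theta> I) (B - \<phi> I) = 0\<close>. Neither factor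
  vanishes there: off the diagonal \<open>B\<close> takes both values 0 and 1, so \<open>B - \<theta> I\<close> is not constant.\<close>

lemma restricted_eigenvalues_of_quadratic:
  fixes B :: "real ^ 'v ^ 'v"
  assumes T: "association_scheme 2 T" and B: "B \<in> relations T"
    and sq: "B ** B = (\<theta> + \<phi>) *\<^sub>R B - (\<theta> * \<phi>) *\<^sub>R mat 1 + c *\<^sub>R all_ones_matrix"
  shows "restricted_eigenvalues T B = {\<theta>, \<phi>}"
proof -
  obtain C where C: "T = {mat 1, B, C}" "mat 1 \<noteq> B" "C \<in> relations T" "C \<noteq> B"
    and IBC: "mat 1 + B + C = all_ones_matrix"
    using two_class_scheme[OF T B] by metis
  have Cne: "C \<noteq> mat 1" using C(3) unfolding relations_def by blast
  have BT: "B \<in> T" using C by blast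
  have sqv: "B *v (B *v w) = (\<theta> + \<phi>) *\<^sub>R (B *v w) - (\<theta> * \<phi>) *\<^sub>R w + c *\<^sub>R (all_ones_matrix *v w)" for w
    using sq by (simp add: matrix_vector_mul_assoc matrix_vector_mult_add_rdistrib
        matrix_vector_mult_diff_rdistrib scaleR_matrix_vector_assoc[symmetric])
  have sub: "\<psi> B \<in> {\<theta>, \<phi>}"
    if n0: "joint_eigenspace T \<psi> \<noteq> {0}" and n1: "joint_eigenspace T \<psi> \<noteq> span {all_ones_vector}" for \<psi>
  proof -
    have J: "all_ones_matrix *v w = (\<psi> (mat 1) + \<psi> B + \<psi> C) *\<^sub>R w" if "w \<in> joint_eigenspace T \<psi>" for w
      using that unfolding joint_eigenspace_def C(1) IBC[symmetric]
      by (simp add: matrix_vector_mult_add_rdistrib scaleR_add_left)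
    have sp: "subspace (joint_eigenspace T \<psi>)"
      unfolding joint_eigenspace_def subspace_def
      by (auto simp: matrix_vector_right_distrib matrix_vector_mult_scaleR algebra_simps)
    then obtain u where u: "u \<in> joint_eigenspace T \<psi>" "u \<noteq> 0"
      using n0 subspace_0 by blast
    \<comment> \<open>This sum is the eigenvalue of \<open>J\<close>. If it is nonzero, the eigenspace lies in the range of \<open>J\<close>,
      which is the span of the all-ones vector.\<close>
    have "\<psi> (mat 1) + \<psi> B + \<psi> C = 0"
    proof (rule ccontr)
      assume s: "\<psi> (mat 1) + \<psi> B + \<psi> C \<noteq> 0" (is "?s \<noteq> 0")
      have in1: "\<exists>r. w = r *\<^sub>R all_ones_vector" if "w \<in> joint_eigenspace T \<psi>" for w
      proof -
        have "?s *\<^sub>R w = (\<Sum>x\<in>UNIV. w $ x) *\<^sub>R all_ones_vector"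
          using J[OF that] all_ones_matrix_mult by metis
        then have "inverse ?s *\<^sub>R (?s *\<^sub>R w) = inverse ?s *\<^sub>R ((\<Sum>x\<in>UNIV. w $ x) *\<^sub>R all_ones_vector)"
          by (rule arg_cong)
        then have "w = (inverse ?s * (\<Sum>x\<in>UNIV. w $ x)) *\<^sub>R all_ones_vector" using s by simp
        then show ?thesis by blast
      qed
      obtain r where r: "u = r *\<^sub>R all_ones_vector" using in1[OF u(1)] by blast
      then have "inverse r *\<^sub>R u = all_ones_vector" using u(2) by auto
      then have "all_ones_vector \<in> joint_eigenspace T \<psi>" using subspace_scale[OF sp u(1)] by metis
      then have "span {all_ones_vector} \<subseteq> joint_eigenspace T \<psi>" using sp by (simp add: span_minimal)
      moreover have "joint_eigenspace T \<psi> \<subseteq> span {all_ones_vector}"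
        using in1 by (auto simp: span_singleton)
      ultimately show False using n1 by blast
    qed
    then have Ju: "all_ones_matrix *v u = 0" using J[OF u(1)] by simp
    have Bu: "B *v u = \<psi> B *\<^sub>R u" using u(1) BT unfolding joint_eigenspace_def by blast
    have "((\<psi> B - \<theta>) * (\<psi> B - \<phi>)) *\<^sub>R u = 0"
      using sqv[of u] unfolding Bu Ju by (simp add: matrix_vector_mult_scaleR Bu algebra_simps)
    then show ?thesis using u(2) by simp
  qed
  have ex: "\<theta>' \<in> restricted_eigenvalues T B"
    if e: "\<theta>' + \<phi>' = \<theta> + \<phi>" "\<theta>' * \<phi>' = \<theta> * \<phi>" for \<theta>' \<phi>'
  proof -
    let ?M = "B - \<phi>' *\<^sub>R mat 1"
    obtain p q where pq: "p \<noteq> q" "B $ p $ q = 1" using relation_nonzero_entry[OF T B] .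
    obtain x y where xy: "x \<noteq> y" "C $ x $ y = 1" using relation_nonzero_entry[OF T C(3)] .
    have B0: "B $ x $ y = 0"
      by (rule scheme_disjoint[OF T _ BT C(4) xy(2)]) (use C in auto)
    have "?M $ i $ j = ?M $ j $ i" for i j
      using scheme_symmetric(2)[OF T BT, of i j] by (simp add: mat_def)
    moreover have "?M $ p $ q \<noteq> ?M $ x $ y" using pq xy B0 by (simp add: mat_def)
    ultimately obtain w where w: "all_ones_matrix *v w = 0" "?M *v w \<noteq> 0"
      using nonconstant_matrix_sum_zero_vector by blast
    \<comment> \<open>The factor \<open>B - \<phi>' I\<close> maps \<open>w\<close> into the kernel of the other factor.\<close>
    define u where "u = B *v w - \<phi>' *\<^sub>R w"
    have u0: "u \<noteq> 0" using w(2) unfolding u_def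
      by (simp add: matrix_vector_mult_diff_rdistrib scaleR_matrix_vector_assoc[symmetric])
    have Ju: "all_ones_matrix *v u = 0"
      using w(1) commutes_with_all_ones[OF T BT] unfolding u_def
      by (metis (no_types) diff_zero matrix_vector_mul_assoc matrix_vector_mult_0_right
          matrix_vector_mult_diff_distrib matrix_vector_mult_scaleR scaleR_zero_right)
    have "B *v u = ((\<theta>' + \<phi>') - \<phi>') *\<^sub>R (B *v w) - (\<theta>' * \<phi>') *\<^sub>R w"
      unfolding u_def e
      by (simp add: matrix_vector_mult_diff_distrib matrix_vector_mult_scaleR sqv w(1) algebra_simps)
    then have Bu: "B *v u = \<theta>' *\<^sub>R u" unfolding u_def by (simp add: algebra_simps)
    have "u + B *v u + C *v u = 0"
      using Ju unfolding IBC[symmetric] by (simp add: matrix_vector_mult_add_rdistrib)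
    then have Cu: "C *v u = (- 1 - \<theta>') *\<^sub>R u"
      unfolding Bu by (simp add: algebra_simps eq_neg_iff_add_eq_0)
    define \<psi> where "\<psi> = (\<lambda>X. if X = mat 1 then 1 else if X = B then \<theta>' else - 1 - \<theta>')"
    have psi: "\<psi> (mat 1) = 1" "\<psi> B = \<theta>'" "\<psi> C = - 1 - \<theta>'"
      using C Cne unfolding \<psi>_def by auto
    have uin: "u \<in> joint_eigenspace T \<psi>" unfolding joint_eigenspace_def C(1) by (simp add: psi Bu Cu)
    have "u \<notin> span {all_ones_vector}"
    proof
      assume "u \<in> span {all_ones_vector}"
      then obtain r where r: "u = r *\<^sub>R all_ones_vector" by (auto simp: span_singleton)
      have "(real CARD('v) * r) *\<^sub>R (all_ones_vector :: real ^ 'v) = 0"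
        using Ju unfolding all_ones_matrix_mult by (simp add: r all_ones_vector_def)
      moreover have "(all_ones_vector :: real ^ 'v) \<noteq> 0" by (simp add: all_ones_vector_def vec_eq_iff)
      ultimately show False using u0 r by simp
    qed
    then have "joint_eigenspace T \<psi> \<noteq> {0} \<and> joint_eigenspace T \<psi> \<noteq> span {all_ones_vector}"
      using uin u0 by blast
    then show ?thesis unfolding restricted_eigenvalues_def using psi(2) by blast
  qed
  have "restricted_eigenvalues T B \<subseteq> {\<theta>, \<phi>}"
    using sub unfolding restricted_eigenvalues_def by blast
  moreover have "\<theta> \<in> restricted_eigenvalues T B" using ex[of \<theta> \<phi>] by blast
  moreover have "\<phi> \<in> restricted_eigenvalues T B" using ex[of \<phi> \<theta>] by (simp add: ac_simps)
  ultimately show ?thesis by blast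
qed

section \<open>Strongly regular graphs with an equitable partition into rows\<close>

text \<open>The function \<open>r\<close> assigns to each vertex the index of its row. The third equation comes from
  the diagonal of \<open>B\<^sup>2\<close>, and the first two from \<open>B\<^sup>2 \<rho>\<close>, where \<open>\<rho>\<close> is the indicator vector of a row:
  the vectors \<open>\<rho>\<close> and \<open>1\<close> are linearly independent because there are at least two rows.\<close>

lemma srg_parameters_from_rows:
  fixes B :: "real ^ 'v ^ 'v" and r :: "'v \<Rightarrow> nat"
  assumes T: "association_scheme 2 T" and B: "B \<in> relations T"
    and sq: "B ** B = a *\<^sub>R mat 1 + b *\<^sub>R B + c *\<^sub>R all_ones_matrix"
    and n: "n \<ge> 2" and r: "\<And>x. r x \<in> {1..n}" and size: "\<And>i. i \<in> {1..n} \<Longrightarrow> card {x. r x = i} = n"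
    and rows: "\<And>x i. i \<in> {1..n} \<Longrightarrow>
      (\<Sum>z | r z = i. B $ x $ z) = (if r x = i then \<alpha> + \<beta> else \<beta>)"
  shows "\<alpha> ^ 2 = a + b * \<alpha>" "\<alpha> * \<beta> + \<beta> * (\<alpha> + n * \<beta>) = b * \<beta> + c * n" "a + c = \<alpha> + n * \<beta>"
    and "\<And>x. (\<Sum>z\<in>UNIV. B $ x $ z) = \<alpha> + n * \<beta>"
proof -
  have BT: "B \<in> T" using B unfolding relations_def by blast
  define \<rho> :: "real ^ 'v" where "\<rho> = (\<chi> z. if r z = 1 then 1 else 0)"
  have one: "(1::nat) \<in> {1..n}" "(2::nat) \<in> {1..n}" using n by auto
  have sum: "(\<Sum>z\<in>UNIV. B $ x $ z) = \<alpha> + n * \<beta>" for x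
  proof -
    have "(\<Sum>z\<in>UNIV. B $ x $ z) = (\<Sum>i\<in>{1..n}. \<Sum>z | z \<in> UNIV \<and> r z = i. B $ x $ z)"
      by (rule sum.group[symmetric]) (use r in auto)
    also have "\<dots> = (\<Sum>i\<in>{1..n}. \<beta> + (if r x = i then \<alpha> else 0))"
      by (rule sum.cong) (use rows in auto)
    also have "\<dots> = \<alpha> + n * \<beta>" using r[of x] by (simp add: sum.distrib)
    finally show ?thesis .
  qed
  then show "(\<Sum>z\<in>UNIV. B $ x $ z) = \<alpha> + n * \<beta>" for x .
  have B1: "B *v all_ones_vector = (\<alpha> + n * \<beta>) *\<^sub>R all_ones_vector"
    by (simp add: matrix_vector_mult_def all_ones_vector_def vec_eq_iff sum)
  have Br: "B *v \<rho> = \<alpha> *\<^sub>R \<rho> + \<beta> *\<^sub>R all_ones_vector"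
  proof -
    have "(B *v \<rho>) $ x = (\<Sum>z | r z = 1. B $ x $ z)" for x
      by (simp add: matrix_vector_mult_def \<rho>_def if_distrib sum.If_cases cong: if_cong)
    then show ?thesis using rows[OF one(1)] by (auto simp: vec_eq_iff \<rho>_def all_ones_vector_def)
  qed
  have "(\<Sum>x\<in>UNIV. \<rho> $ x) = n" using size[OF one(1)] by (simp add: \<rho>_def sum.If_cases)
  then have Jr: "all_ones_matrix *v \<rho> = real n *\<^sub>R all_ones_vector" by (simp add: all_ones_matrix_mult)
  have "B *v (B *v \<rho>) = a *\<^sub>R \<rho> + b *\<^sub>R (B *v \<rho>) + c *\<^sub>R (all_ones_matrix *v \<rho>)"
    by (simp add: matrix_vector_mul_assoc sq matrix_vector_mult_add_rdistrib
        scaleR_matrix_vector_assoc[symmetric])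
  then have "\<alpha> *\<^sub>R (\<alpha> *\<^sub>R \<rho> + \<beta> *\<^sub>R all_ones_vector) + (\<beta> * (\<alpha> + n * \<beta>)) *\<^sub>R all_ones_vector =
      a *\<^sub>R \<rho> + b *\<^sub>R (\<alpha> *\<^sub>R \<rho> + \<beta> *\<^sub>R all_ones_vector) + (c * n) *\<^sub>R all_ones_vector"
    by (simp add: Br Jr matrix_vector_right_distrib matrix_vector_mult_scaleR B1)
  then have ev: "\<alpha> * (\<alpha> * \<rho> $ x + \<beta>) + \<beta> * (\<alpha> + n * \<beta>) = a * \<rho> $ x + b * (\<alpha> * \<rho> $ x + \<beta>) + c * n" for x
    by (auto simp: vec_eq_iff all_ones_vector_def dest: spec[of _ x])
  have "{x. r x = i} \<noteq> {}" if "i \<in> {1..n}" for i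
    using size[OF that] n by (metis card.empty not_numeral_le_zero)
  then obtain x y where xy: "r x = 1" "r y = 2" using one by blast
  show e2: "\<alpha> * \<beta> + \<beta> * (\<alpha> + n * \<beta>) = b * \<beta> + c * n" using ev[of y] xy by (simp add: \<rho>_def)
  show "\<alpha> ^ 2 = a + b * \<alpha>"
    using ev[of x] xy e2 by (simp add: \<rho>_def power2_eq_square algebra_simps)
  have "(B ** B) $ x $ x = (\<Sum>z\<in>UNIV. B $ x $ z)"
    unfolding matrix_matrix_mult_def vec_lambda_beta
  proof (rule sum.cong[OF refl])
    show "B $ x $ z * B $ z $ x = B $ x $ z" for z
      using scheme_symmetric(2)[OF T BT, of x z] scheme_entry[OF T BT, of x z] by auto
  qed
  moreover have "(B ** B) $ x $ x = a + c"
    unfolding sq using relation_diagonal[OF T B] by (simp add: mat_def all_ones_matrix_def)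
  ultimately show "a + c = \<alpha> + n * \<beta>" using sum by simp
qed

lemma has_valency_iff_row_sums:
  assumes S: "association_scheme d S" and A: "A \<in> S"
  shows "has_valency A k \<longleftrightarrow> (\<forall>x. (\<Sum>z\<in>UNIV. A $ x $ z) = real k)"
proof -
  have "(\<Sum>z\<in>UNIV. A $ x $ z) = card {z. A $ x $ z = 1}" for x
  proof -
    have "(\<Sum>z\<in>UNIV. A $ x $ z) = (\<Sum>z\<in>UNIV. if A $ x $ z = 1 then 1 else 0)"
      by (rule sum.cong) (use scheme_entry[OF S A] in auto)
    then show ?thesis by (simp add: sum.If_cases)
  qed
  then show ?thesis unfolding has_valency_def by simp
qed

lemma latin_square_type_of_square:
  fixes B :: "real ^ 'v ^ 'v"
  assumes T: "association_scheme 2 T" and B: "B \<in> relations T"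
    and "n > 0" "t > 0" and v: "CARD('v) = n ^ 2"
    and k: "\<And>x. (\<Sum>z\<in>UNIV. B $ x $ z) = real t * (real n - 1)"
    and sq: "B ** B = (t * (real n - t)) *\<^sub>R mat 1 + (real n - 2 * real t) *\<^sub>R B + c *\<^sub>R all_ones_matrix"
  shows "latin_square_type B"
proof -
  have BT: "B \<in> T" using B unfolding relations_def by blast
  have "B ** B = ((real n - t) + (- real t)) *\<^sub>R B - ((real n - t) * (- real t)) *\<^sub>R mat 1
      + c *\<^sub>R all_ones_matrix"
    unfolding sq by (simp add: algebra_simps)
  then have "restricted_eigenvalues T B = {real n - t, - real t}"
    by (rule restricted_eigenvalues_of_quadratic[OF T B])
  moreover have "has_valency B (t * (n - 1))"
    using k \<open>n > 0\<close> by (simp add: has_valency_iff_row_sums[OF T BT] of_nat_diff)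
  ultimately show ?thesis unfolding latin_square_type_def using assms(1-5) by blast
qed

section \<open>Rows of the lattice graph\<close>

text \<open>The cell in row \<open>i\<close> and in the column of \<open>x\<close> is \<open>L\<close>-related to \<open>x\<close>, and the entry of \<open>B L\<close>
  there counts the \<open>B\<close>-neighbours of \<open>x\<close> in row \<open>i\<close>.\<close>

lemma neighbours_in_lattice_row:
  fixes B :: "real ^ 'v ^ 'v"
  assumes S: "association_scheme d S" and L: "L \<in> relations S" and B: "B \<in> relations S"
    and BL: "B \<noteq> L"
    and f: "bij_betw f UNIV (lattice_vertices n)"
    and Lf: "L = (\<chi> x y. if lattice_adjacent (f x) (f y) then 1 else 0)"
  shows "\<exists>t :: nat. \<forall>x. \<forall>i\<in>{1..n}.
    (\<Sum>z | fst (f z) = i. B $ x $ z) = (if fst (f x) = i then 0 else real t)"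
proof -
  have LS: "L \<in> S" and BS: "B \<in> S" using L B unfolding relations_def by auto
  have inj: "f x = f y \<longleftrightarrow> x = y" for x y
    using f by (meson UNIV_I bij_betw_def inj_on_def)
  have rng: "f x \<in> lattice_vertices n" for x using f by (meson UNIV_I bij_betwE)
  have off: "fst (f z) \<noteq> fst (f x) \<and> snd (f z) \<noteq> snd (f x)" if "B $ x $ z = 1" for x z
  proof -
    have "L $ x $ z = 0" using scheme_disjoint[OF S BS LS BL that] .
    moreover have "x \<noteq> z" using that relation_diagonal[OF S B] by (metis zero_neq_one)
    ultimately show ?thesis using inj[of x z]
      by (auto simp: Lf lattice_adjacent_def split: if_splits)
  qed
  have prod: "B ** L \<in> span S"
    using S span_base[OF LS] span_base[OF BS] unfolding association_scheme_def by blast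
  have cell: "\<exists>y. L $ x $ y = 1 \<and> (\<Sum>z | fst (f z) = i. B $ x $ z) = (B ** L) $ x $ y"
    if i: "i \<in> {1..n}" "fst (f x) \<noteq> i" for x i
  proof -
    have "(i, snd (f x)) \<in> lattice_vertices n" using rng[of x] i by (auto simp: lattice_vertices_def)
    then obtain y where y: "f y = (i, snd (f x))" using f by (metis bij_betw_iff_bijections)
    have "(B ** L) $ x $ y = (\<Sum>z\<in>UNIV. if fst (f z) = i then B $ x $ z else 0)"
      unfolding matrix_matrix_mult_def vec_lambda_beta
    proof (rule sum.cong[OF refl])
      show "B $ x $ z * L $ z $ y = (if fst (f z) = i then B $ x $ z else 0)" for z
        using scheme_entry[OF S BS, of x z] off[of x z] y
        by (auto simp: Lf lattice_adjacent_def)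
    qed
    also have "\<dots> = (\<Sum>z | fst (f z) = i. B $ x $ z)" by (simp add: sum.If_cases)
    finally have "(\<Sum>z | fst (f z) = i. B $ x $ z) = (B ** L) $ x $ y" by simp
    moreover have "f x \<noteq> f y" using y i by (metis fst_conv)
    then have "L $ x $ y = 1" using y by (simp add: Lf lattice_adjacent_def)
    ultimately show ?thesis by blast
  qed
  have own: "(\<Sum>z | fst (f z) = fst (f x). B $ x $ z) = 0" for x
    by (rule sum.neutral) (use off scheme_entry[OF S BS] in blast)
  have nat: "\<exists>m::nat. (\<Sum>z | fst (f z) = i. B $ x $ z) = real m" for x i
  proof -
    have "(\<Sum>z | fst (f z) = i. B $ x $ z) = (\<Sum>z | fst (f z) = i. real (if B $ x $ z = 1 then 1 else 0))"
      by (rule sum.cong) (use scheme_entry[OF S BS] in auto)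
    then show ?thesis unfolding of_nat_sum[symmetric] by blast
  qed
  obtain x0 y0 where xy0: "L $ x0 $ y0 = 1" using relation_nonzero_entry[OF S L] by metis
  have const: "(\<Sum>z | fst (f z) = i. B $ x $ z) = (B ** L) $ x0 $ y0"
    if "i \<in> {1..n}" "fst (f x) \<noteq> i" for x i
    using cell[OF that] span_constant_on_relation[OF S LS prod _ xy0] by metis
  have "\<exists>m::nat. \<forall>x. \<forall>i\<in>{1..n}. fst (f x) \<noteq> i \<longrightarrow> (\<Sum>z | fst (f z) = i. B $ x $ z) = real m"
    using const nat by metis
  then show ?thesis using own by auto
qed

lemma lattice_row_card:
  assumes f: "bij_betw f UNIV (lattice_vertices n)" and i: "i \<in> {1..n}"
  shows "card {x. fst (f x) = i} = n"
proof -
  have "bij_betw f {x. fst (f x) = i} ({i} \<times> {1..n})"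
  proof (rule bij_betw_subset[OF f])
    show "f ` {x. fst (f x) = i} = {i} \<times> {1..n}"
    proof
      show "f ` {x. fst (f x) = i} \<subseteq> {i} \<times> {1..n}"
      proof
        fix p assume "p \<in> f ` {x. fst (f x) = i}"
        then have "p \<in> lattice_vertices n" "fst p = i" using bij_betwE[OF f] by auto
        then show "p \<in> {i} \<times> {1..n}" by (auto simp: lattice_vertices_def)
      qed
      show "{i} \<times> {1..n} \<subseteq> f ` {x. fst (f x) = i}"
      proof
        fix p assume p: "p \<in> {i} \<times> {1..n}"
        then have "p \<in> lattice_vertices n" using i by (auto simp: lattice_vertices_def)
        then obtain x where "f x = p" using f by (metis bij_betw_iff_bijections)
        then show "p \<in> f ` {x. fst (f x) = i}" using p by (auto intro!: image_eqI[of p f x])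
      qed
    qed
  qed simp
  then show ?thesis by (simp add: bij_betw_same_card card_cartesian_product)
qed

lemma lattice_row_sums:
  fixes L :: "real ^ 'v ^ 'v"
  assumes f: "bij_betw f UNIV (lattice_vertices n)" and i: "i \<in> {1..n}"
    and Lf: "L = (\<chi> x y. if lattice_adjacent (f x) (f y) then 1 else 0)"
  shows "(\<Sum>z | fst (f z) = i. L $ x $ z) = (if fst (f x) = i then (real n - 2) + 1 else 1)"
proof -
  have inj: "f x = f y \<longleftrightarrow> x = y" for x y
    using f by (meson UNIV_I bij_betw_def inj_on_def)
  show ?thesis
  proof (cases "fst (f x) = i")
    case True
    have "(\<Sum>z | fst (f z) = i. L $ x $ z) = (\<Sum>z | fst (f z) = i. 1 - (if z = x then 1 else 0))"
      by (rule sum.cong) (use True inj in \<open>auto simp: Lf lattice_adjacent_def\<close>)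
    also have "\<dots> = real n - 1"
      using True lattice_row_card[OF f i] by (simp add: sum_subtractf)
    finally show ?thesis using True by simp
  next
    case False
    have "f x \<in> lattice_vertices n" using f by (meson UNIV_I bij_betwE)
    then have "(i, snd (f x)) \<in> lattice_vertices n" using i by (auto simp: lattice_vertices_def)
    then obtain y where y: "f y = (i, snd (f x))" using f by (metis bij_betw_iff_bijections)
    have "(\<Sum>z | fst (f z) = i. L $ x $ z) = (\<Sum>z | fst (f z) = i. if z = y then 1 else 0)"
    proof (rule sum.cong[OF refl])
      fix z assume "z \<in> {z. fst (f z) = i}"
      then show "L $ x $ z = (if z = y then 1 else 0)"
        using False y inj[of z y] by (auto simp: Lf lattice_adjacent_def prod_eq_iff)
    qed
    also have "\<dots> = 1" using y by simp
    finally show ?thesis using False by simp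
  qed
qed

section \<open>Strongly regular relations are of Latin square type\<close>

theorem proposition7p4:
  fixes S :: "(real ^ 'v ^ 'v) set" and L B :: "real ^ 'v ^ 'v" and d n :: nat
  assumes "association_scheme d S"
    and "L \<in> relations S" and "is_lattice_graph n L"
    and "B \<in> relations S" and "strongly_regular B"
  shows "latin_square_type B"
proof -
  note S = assms(1) and L = assms(2) and B = assms(4)
  obtain f where f: "bij_betw f UNIV (lattice_vertices n)"
    and Lf: "L = (\<chi> x y. if lattice_adjacent (f x) (f y) then 1 else 0)"
    using assms(3) unfolding is_lattice_graph_def by blast
  obtain T where T: "association_scheme 2 T" "B \<in> relations T"
    using assms(5) unfolding strongly_regular_def by blast
  obtain a b c where sq: "B ** B = a *\<^sub>R mat 1 + b *\<^sub>R B + c *\<^sub>R all_ones_matrix"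
    using two_class_square[OF T] .
  have rng: "f x \<in> lattice_vertices n" for x using f by (meson UNIV_I bij_betwE)
  have r: "fst (f x) \<in> {1..n}" for x using rng[of x] by (auto simp: lattice_vertices_def)
  have v: "CARD('v) = n ^ 2"
    using bij_betw_same_card[OF f]
    by (simp add: lattice_vertices_def card_cartesian_product power2_eq_square)
  \<comment> \<open>A lattice graph with an edge has at least two rows.\<close>
  have n: "n \<ge> 2"
  proof (rule ccontr)
    assume "\<not> n \<ge> 2"
    then have "n = 0 \<or> n = 1" by linarith
    then have "CARD('v) \<le> 1" using v by auto
    moreover obtain x y where "x \<noteq> y" "L $ x $ y = 1" using relation_nonzero_entry[OF S L] .
    ultimately show False using card_le_Suc0_iff_eq[of "UNIV :: 'v set"] by auto
  qed
  note par = srg_parameters_from_rows[OF T sq n r lattice_row_card[OF f]]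
  show ?thesis
  proof (cases "B = L")
    case True
    note rows = lattice_row_sums[OF f _ Lf, folded True]
    note eqs = par[OF _ rows]
    have e: "(real n - 2) ^ 2 = a + b * (real n - 2)" "(real n - 2) + (real n - 2 + n) = b + c * n"
      "a + c = real n - 2 + n" using eqs(1-3) by simp_all
    \<comment> \<open>Eliminate \<open>a\<close> and \<open>b\<close>.\<close>
    have "(real n - 1) ^ 2 * (c - 2) = 0" using e by algebra
    then have c: "c = 2" using n by simp
    have b: "b = real n - 2 * real 2" using e c by simp
    have a: "a = real 2 * (real n - real 2)" using e c by simp
    show ?thesis
    proof (rule latin_square_type_of_square[OF T _ _ v])
      show "B ** B = (real 2 * (real n - real 2)) *\<^sub>R mat 1 + (real n - 2 * real 2) *\<^sub>R B
          + c *\<^sub>R all_ones_matrix" using sq a b by simp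
      show "(\<Sum>z\<in>UNIV. B $ x $ z) = real 2 * (real n - 1)" for x using eqs(4)[of x] by simp
    qed (use n in auto)
  next
    case False
    obtain t :: nat where t: "\<forall>x. \<forall>i\<in>{1..n}.
        (\<Sum>z | fst (f z) = i. B $ x $ z) = (if fst (f x) = i then 0 else real t)"
      using neighbours_in_lattice_row[OF S L B False f Lf] by blast
    have "(\<Sum>z | fst (f z) = i. B $ x $ z) = (if fst (f x) = i then - real t + real t else real t)"
      if "i \<in> {1..n}" for x i using t that by simp
    note eqs = par[OF _ this]
    have k: "(\<Sum>z\<in>UNIV. B $ x $ z) = real t * (real n - 1)" for x
      using eqs(4)[of x] by (simp add: algebra_simps)
    have BT: "B \<in> T" using T(2) unfolding relations_def by blast
    have t0: "t > 0"
    proof (rule ccontr)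
      assume "\<not> t > 0"
      obtain x y where xy: "B $ x $ y = 1" using relation_nonzero_entry[OF T] by metis
      have "B $ x $ y \<le> (\<Sum>z\<in>UNIV. B $ x $ z)"
        by (rule member_le_sum) (use scheme_entry[OF T(1) BT] in \<open>auto, metis zero_le_one order_refl\<close>)
      then show False using k[of x] xy \<open>\<not> t > 0\<close> by simp
    qed
    have e: "real t ^ 2 = a - b * t" "- (real t * t) + t * (- real t + real n * real t) = b * t + c * n"
      "a + c = - real t + n * real t" using eqs(1-3) by simp_all
    \<comment> \<open>Again \<open>a\<close> and \<open>b\<close> are eliminated.\<close>
    have "(real n - 1) * (c - t * (real t - 1)) = 0" using e by algebra
    then have c: "c = t * (real t - 1)" using n by simp
    have a: "a = t * (real n - t)" using e c by (simp add: algebra_simps)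
    have "real t * (b - (real n - 2 * real t)) = 0" using e a by (simp add: power2_eq_square algebra_simps)
    then have b: "b = real n - 2 * real t" using t0 by simp
    show ?thesis
    proof (rule latin_square_type_of_square[OF T _ t0 v k])
      show "B ** B = (t * (real n - t)) *\<^sub>R mat 1 + (real n - 2 * real t) *\<^sub>R B + c *\<^sub>R all_ones_matrix"
        using sq a b by simp
    qed (use n in simp)
  qed
qed

end
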